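(* Let $V$ be a finite-dimensional vector space over $\mathbb{Q}$ with a non-degenerate quadratic form $q$ of signature $(d^+,d^-)$, and let $L\subset V$ be a lattice. Let $C\subseteq[V(\mathbb{R})^+]$ be a closed subset of $\mathbb{P}(V(\mathbb{R}))$, and let $\mathcal{C}(C):=\{v\in V(\mathbb{R})\setminus\{0\} : [v]\in C\}$. Then the theta series $$\theta_L(\mathcal{C}(C);\tau,z)=\sum_{\substack{l\in L\\ l+\frac{v}{y}\in\mathcal{C}(C)}}\exp\bigl(2\pi i(q(l)\tau+\langle z,l\rangle)\bigr),\qquad \tau=x+iy\in\mathbb{H},\ z=u+iv\in V(\mathbb{C}),$$ converges absolutely and uniformly on compact subsets of $\mathbb{H}\times V(\mathbb{C})$.
   Context: $\langle x,y\rangle=q(x+y)-q(x)-q(y)$ is the bilinear form of $q$; $V(\mathbb{R})=V\otimes\mathbb{R}$, $V(\mathbb{C})=V\otimes\mathbb{C}$, with $q$ and $\langle\cdot,\cdot\rangle$ extended $\mathbb{R}$- resp. $\mathbb{C}$-bilinearly. A lattice is a finitely generated $\mathbb{Z}$-submodule of $V$ spanning $V$. $V(\mathbb{R})^+=\{v\in V(\mathbb{R}): q(v)>0\}$. $\mathbb{P}(V(\mathbb{R}))=(V(\mathbb{R})\setminus\{0\})/\mathbb{R}^\times$, $[v]$ is the class of $v$, and for $S\subseteq V(\mathbb{R})$, $[S]=\{[v]: v\in S\setminus\{0\}\}$. $\mathbb{H}$ is the upper half-plane; $y=\mathrm{Im}\,\tau$, $v=\mathrm{Im}\,z\in V(\mathbb{R})$.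 *)

theory Defs
  imports "HOL-Analysis.Analysis" "HOL-Library.Poly_Mapping"
begin

section \<open>Vector spaces over the rationals, quadratic forms, lattices\<close>

class rat_vector = ab_group_add +
  fixes scaleQ :: "rat \<Rightarrow> 'a \<Rightarrow> 'a"
  assumes scaleQ_add_right: "scaleQ a (x + y) = scaleQ a x + scaleQ a y"
    and scaleQ_add_left: "scaleQ (a + b) x = scaleQ a x + scaleQ b x"
    and scaleQ_scaleQ: "scaleQ a (scaleQ b x) = scaleQ (a * b) x"
    and scaleQ_one: "scaleQ 1 x = x"

global_interpretation rat_vector: vector_space "scaleQ :: rat \<Rightarrow> 'a \<Rightarrow> 'a::rat_vector"
  by unfold_locales (fact scaleQ_add_right scaleQ_add_left scaleQ_scaleQ scaleQ_one)+

global_interpretation int_module: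
  module "\<lambda>n. scaleQ (rat_of_int n) :: 'a \<Rightarrow> 'a::rat_vector"
  by unfold_locales (simp_all add: scaleQ_add_right scaleQ_add_left scaleQ_scaleQ scaleQ_one)

definition bilinear_over ::
  "('k::field \<Rightarrow> 'a::ab_group_add \<Rightarrow> 'a) \<Rightarrow> ('a \<Rightarrow> 'a \<Rightarrow> 'k) \<Rightarrow> bool" where
  "bilinear_over s B \<longleftrightarrow>
     (\<forall>x. Vector_Spaces.linear s (*) (\<lambda>y. B x y)) \<and>
     (\<forall>y. Vector_Spaces.linear s (*) (\<lambda>x. B x y))"

definition polar :: "('v::rat_vector \<Rightarrow> rat) \<Rightarrow> 'v \<Rightarrow> 'v \<Rightarrow> rat" where
  "polar q x y = q (x + y) - q x - q y"

definition quadratic_form :: "('v::rat_vector \<Rightarrow> rat) \<Rightarrow> bool" where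
  "quadratic_form q \<longleftrightarrow>
     (\<forall>a x. q (scaleQ a x) = a\<^sup>2 * q x) \<and> bilinear_over scaleQ (polar q)"

definition nondegenerate :: "('v::rat_vector \<Rightarrow> rat) \<Rightarrow> bool" where
  "nondegenerate q \<longleftrightarrow> (\<forall>x. (\<forall>y. polar q x y = 0) \<longrightarrow> x = 0)"

definition is_lattice :: "'v::rat_vector set \<Rightarrow> bool" where
  "is_lattice L \<longleftrightarrow> (\<exists>S. finite S \<and> L = int_module.span S) \<and> rat_vector.span L = UNIV"


section \<open>Extension of scalars\<close>

text \<open>
  The tensor product of a rational vector space \<open>V\<close> with a field \<open>K\<close> of characteristic zero
  is the free \<open>K\<close>-vector space on the set \<open>V\<close> (finitely supported functions, \<open>single x c\<close> being
  the generator that becomes \<open>x \<otimes> c\<close>) modulo the \<open>K\<close>-subspace generated by the relations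
  \<open>(x + y) \<otimes> 1 = x \<otimes> 1 + y \<otimes> 1\<close> and \<open>(a x) \<otimes> 1 = x \<otimes> a\<close> for rational \<open>a\<close>.
\<close>

lemma lookup_map_zero: "f 0 = 0 \<Longrightarrow> Poly_Mapping.lookup (Poly_Mapping.map f p) k = f (Poly_Mapping.lookup p k)"
  by (simp add: Poly_Mapping.map.rep_eq when_def)

global_interpretation free_vs:
  vector_space "\<lambda>c. Poly_Mapping.map ((*) c) :: ('v \<Rightarrow>\<^sub>0 'k) \<Rightarrow> ('v \<Rightarrow>\<^sub>0 'k::field)"
  by unfold_locales
    (auto intro!: poly_mapping_eqI simp: lookup_map_zero lookup_add algebra_simps)

definition tensor_relations :: "('v::rat_vector \<Rightarrow>\<^sub>0 'k::field_char_0) set" where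
  "tensor_relations =
     range (\<lambda>(x, y). Poly_Mapping.single (x + y) 1
                      - Poly_Mapping.single x 1 - Poly_Mapping.single y 1) \<union>
     range (\<lambda>(a, x). Poly_Mapping.single (scaleQ a x) 1 - Poly_Mapping.single x (of_rat a))"

definition tensor_eq ::
  "('v::rat_vector \<Rightarrow>\<^sub>0 'k::field_char_0) \<Rightarrow> ('v \<Rightarrow>\<^sub>0 'k) \<Rightarrow> bool" where
  "tensor_eq p p' \<longleftrightarrow> p - p' \<in> free_vs.span tensor_relations"

lemma tensor_eq_trans:
  assumes "tensor_eq p p'" "tensor_eq p' p''"
  shows "tensor_eq p p''"
  using free_vs.span_add[of "p - p'" _ "p' - p''"] assms by (simp add: tensor_eq_def)

lemma tensor_eq_sym:
  assumes "tensor_eq p p'"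
  shows "tensor_eq p' p"
  using free_vs.span_neg[of "p - p'"] assms by (simp add: tensor_eq_def)

lemma equivp_tensor_eq: "equivp tensor_eq"
proof (rule equivpI)
  show "reflp tensor_eq"
    by (simp add: reflp_def tensor_eq_def free_vs.span_zero)
qed (use tensor_eq_sym tensor_eq_trans in \<open>blast intro: sympI transpI\<close>)+

quotient_type (overloaded) ('v, 'k) scal_ext =
  "'v::rat_vector \<Rightarrow>\<^sub>0 'k::field_char_0" / tensor_eq
  by (fact equivp_tensor_eq)

instantiation scal_ext :: (rat_vector, field_char_0) ab_group_add
begin

lift_definition zero_scal_ext :: "('a, 'b) scal_ext" is 0 .

lift_definition plus_scal_ext ::
  "('a, 'b) scal_ext \<Rightarrow> ('a, 'b) scal_ext \<Rightarrow> ('a, 'b) scal_ext" is "(+)"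
  unfolding tensor_eq_def by (metis free_vs.span_add add_diff_add)

lift_definition minus_scal_ext ::
  "('a, 'b) scal_ext \<Rightarrow> ('a, 'b) scal_ext \<Rightarrow> ('a, 'b) scal_ext" is "(-)"
proof -
  fix p p' r r' :: "'a \<Rightarrow>\<^sub>0 'b"
  assume "tensor_eq p p'" "tensor_eq r r'"
  then have "(p - p') - (r - r') \<in> free_vs.span tensor_relations"
    unfolding tensor_eq_def by (rule free_vs.span_diff)
  then show "tensor_eq (p - r) (p' - r')"
    unfolding tensor_eq_def by (simp add: algebra_simps)
qed

lift_definition uminus_scal_ext :: "('a, 'b) scal_ext \<Rightarrow> ('a, 'b) scal_ext" is "uminus"
  unfolding tensor_eq_def by (metis free_vs.span_neg minus_diff_eq minus_diff_minus)

instance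
  by intro_classes (transfer; simp add: tensor_eq_def free_vs.span_zero algebra_simps)+

end

lift_definition scaleK ::
  "'k \<Rightarrow> ('v::rat_vector, 'k::field_char_0) scal_ext \<Rightarrow> ('v, 'k) scal_ext"
  is "\<lambda>c. Poly_Mapping.map ((*) c)"
  unfolding tensor_eq_def by (metis free_vs.span_scale free_vs.scale_right_diff_distrib)

global_interpretation scal_ext:
  vector_space "scaleK :: 'k \<Rightarrow> _ \<Rightarrow> ('v::rat_vector, 'k::field_char_0) scal_ext"
  by unfold_locales
    (transfer; simp add: tensor_eq_def free_vs.span_zero free_vs.scale_right_distrib
       free_vs.scale_left_distrib del: free_vs.scale_scale;
     simp add: free_vs.span_zero)+

lift_definition embed :: "'v::rat_vector \<Rightarrow> ('v, 'k::field_char_0) scal_ext"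
  is "\<lambda>x. Poly_Mapping.single x 1" .

text \<open>
  The initial topology with respect to all \<open>K\<close>-linear functionals. For finite-dimensional \<open>V\<close>
  and \<open>K\<close> the real or complex numbers, this is the usual topology of a finite-dimensional
  vector space (the product topology in the coordinates of any basis).
\<close>

instantiation scal_ext :: (rat_vector, "{field_char_0, topological_space}") topological_space
begin

definition open_scal_ext :: "('a, 'b) scal_ext set \<Rightarrow> bool" where
  "open_scal_ext =
     generate_topology {f -` U | f U. Vector_Spaces.linear scaleK (*) f \<and> open U}"

instance
  by intro_classes (auto simp: open_scal_ext_def intro: generate_topology.intros)

end

lemma scal_ext_span_embed:
  "scal_ext.span (range embed) = (UNIV :: ('v::rat_vector, 'k::field_char_0) scal_ext set)"
proof -
  have "abs_scal_ext p \<in> scal_ext.span (range embed)" for p :: "'v \<Rightarrow>\<^sub>0 'k"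
  proof (induction p rule: update_induct)
    case const
    then show ?case
      by (metis zero_scal_ext.abs_eq scal_ext.span_zero)
  next
    case (update p x c)
    have "Poly_Mapping.update x c p = p + Poly_Mapping.map ((*) c) (Poly_Mapping.single x 1)"
      using update by (intro poly_mapping_eqI)
        (auto simp: lookup_update lookup_add lookup_map_zero lookup_single in_keys_iff)
    then have "abs_scal_ext (Poly_Mapping.update x c p) = abs_scal_ext p + scaleK c (embed x)"
      by (simp only: plus_scal_ext.abs_eq scaleK.abs_eq embed.abs_eq)
    then show ?case
      using update by (simp add: scal_ext.span_add scal_ext.span_scale scal_ext.span_base)
  qed
  then show ?thesis
    by (metis UNIV_eq_I Quotient3_abs_rep[OF Quotient3_scal_ext])
qed

definition free_ext :: "('v \<Rightarrow> 'k::field) \<Rightarrow> ('v \<Rightarrow>\<^sub>0 'k) \<Rightarrow> 'k" where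
  "free_ext f p = (\<Sum>x \<in> Poly_Mapping.keys p. Poly_Mapping.lookup p x * f x)"

lemma free_ext_superset:
  "finite A \<Longrightarrow> Poly_Mapping.keys p \<subseteq> A \<Longrightarrow>
     free_ext f p = (\<Sum>x \<in> A. Poly_Mapping.lookup p x * f x)"
  unfolding free_ext_def by (rule sum.mono_neutral_left) (auto simp: in_keys_iff)

lemma free_ext_add: "free_ext f (p + p') = free_ext f p + free_ext f p'"
proof -
  let ?A = "Poly_Mapping.keys p \<union> Poly_Mapping.keys p'"
  have "Poly_Mapping.keys (p + p') \<subseteq> ?A" by (rule keys_add)
  then show ?thesis
    by (simp add: free_ext_superset[of ?A] lookup_add algebra_simps sum.distrib)
qed

lemma free_ext_scale: "free_ext f (Poly_Mapping.map ((*) c) p) = c * free_ext f p"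
proof -
  have "Poly_Mapping.keys (Poly_Mapping.map ((*) c) p) \<subseteq> Poly_Mapping.keys p"
    by (auto simp: in_keys_iff lookup_map_zero)
  then show ?thesis
    by (simp add: free_ext_superset[of "Poly_Mapping.keys p"] lookup_map_zero sum_distrib_left
        algebra_simps)
qed

lemma free_ext_diff: "free_ext f (p - p') = free_ext f p - free_ext f p'"
  using free_ext_add[of f "p - p'" p'] by simp

lemma free_ext_single: "free_ext f (Poly_Mapping.single x c) = c * f x"
  by (simp add: free_ext_superset[of "{x}"])

definition rat_linear :: "('v::rat_vector \<Rightarrow> 'k::field_char_0) \<Rightarrow> bool" where
  "rat_linear f \<longleftrightarrow> (\<forall>x y. f (x + y) = f x + f y) \<and> (\<forall>a x. f (scaleQ a x) = of_rat a * f x)"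

lemma free_ext_cong:
  assumes "rat_linear f" "tensor_eq p p'"
  shows "free_ext f p = free_ext f p'"
proof -
  have "free_ext f r = 0" if "r \<in> free_vs.span tensor_relations" for r
    using that
  proof (induction rule: free_vs.span_induct_alt)
    case base
    show ?case by (simp add: free_ext_def)
  next
    case (step c r p)
    have "free_ext f r = 0"
      using step.hyps(1) assms(1)
      by (auto simp: tensor_relations_def free_ext_diff free_ext_single rat_linear_def)
    then show ?case using step.IH by (simp add: free_ext_add free_ext_scale)
  qed
  from this[of "p - p'"] assms(2) show ?thesis
    by (simp add: tensor_eq_def free_ext_diff)
qed

definition lin_ext :: "('v::rat_vector \<Rightarrow> 'k) \<Rightarrow> ('v, 'k::field_char_0) scal_ext \<Rightarrow> 'k" where
  "lin_ext f w = free_ext f (rep_scal_ext w)"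

lemma lin_ext_abs: "rat_linear f \<Longrightarrow> lin_ext f (abs_scal_ext p) = free_ext f p"
  unfolding lin_ext_def
  by (rule free_ext_cong) (auto intro: rep_abs_rsp_left[OF Quotient3_scal_ext] equivp_reflp[OF equivp_tensor_eq])

lemma scal_ext_exhaust: obtains p where "w = abs_scal_ext p"
  by (metis Quotient3_abs_rep[OF Quotient3_scal_ext])

lemma linear_lin_ext:
  assumes "rat_linear f"
  shows "Vector_Spaces.linear scaleK (*) (lin_ext f)"
proof unfold_locales
  show "lin_ext f (w + w') = lin_ext f w + lin_ext f w'" for w w'
    by (cases w rule: scal_ext_exhaust, cases w' rule: scal_ext_exhaust)
      (simp add: plus_scal_ext.abs_eq lin_ext_abs[OF assms] free_ext_add)
  show "lin_ext f (scaleK c w) = c * lin_ext f w" for c w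
    by (cases w rule: scal_ext_exhaust)
      (simp add: scaleK.abs_eq lin_ext_abs[OF assms] free_ext_scale)
qed

lemma lin_ext_embed: "rat_linear f \<Longrightarrow> lin_ext f (embed x) = f x"
  by (simp add: embed.abs_eq lin_ext_abs free_ext_single)

lemma linearD:
  assumes "Vector_Spaces.linear s t f"
  shows "f (x + y) = f x + f y" "f (s c x) = t c (f x)"
proof -
  interpret Vector_Spaces.linear s t f by fact
  show "f (x + y) = f x + f y" "f (s c x) = t c (f x)" by (fact add scale)+
qed

lemma ex1_bilinear_ext:
  fixes b :: "'v::rat_vector \<Rightarrow> 'v \<Rightarrow> rat"
  assumes "bilinear_over scaleQ b"
  shows "\<exists>!B :: ('v, 'k::field_char_0) scal_ext \<Rightarrow> _ \<Rightarrow> 'k. bilinear_over scaleK B \<and>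
     (\<forall>x y. B (embed x) (embed y) = of_rat (b x y))"
proof (rule ex_ex1I)
  have l: "Vector_Spaces.linear scaleQ (*) (b x)" "Vector_Spaces.linear scaleQ (*) (\<lambda>x. b x y)" for x y
    using assms by (auto simp: bilinear_over_def)
  note b = linearD(1)[OF l(1)] linearD(2)[OF l(1)]
    linearD(1)[OF l(2)] linearD(2)[OF l(2)]
  define g :: "'v \<Rightarrow> ('v, 'k) scal_ext \<Rightarrow> 'k" where "g x = lin_ext (\<lambda>y. of_rat (b x y))" for x
  have r1: "rat_linear (\<lambda>y. of_rat (b x y) :: 'k)" for x
    by (simp add: rat_linear_def b of_rat_add of_rat_mult)
  have r2: "rat_linear (\<lambda>x. g x w)" for w
    by (simp add: rat_linear_def g_def lin_ext_def free_ext_def b of_rat_add of_rat_mult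
        algebra_simps sum.distrib sum_distrib_left)
  define B :: "('v, 'k) scal_ext \<Rightarrow> ('v, 'k) scal_ext \<Rightarrow> 'k" where
    "B w w' = lin_ext (\<lambda>x. g x w') w" for w w'
  have lg: "Vector_Spaces.linear scaleK (*) (g x)" for x
    unfolding g_def by (rule linear_lin_ext[OF r1])
  have "Vector_Spaces.linear scaleK (*) (\<lambda>w'. B w w')" for w
  proof unfold_locales
    show "B w (u + u') = B w u + B w u'" for u u'
      by (simp add: B_def lin_ext_def free_ext_def linearD(1)[OF lg]
          algebra_simps sum.distrib)
    show "B w (scaleK c u) = c * B w u" for c u
      by (simp add: B_def lin_ext_def free_ext_def linearD(2)[OF lg]
          algebra_simps sum_distrib_left)
  qed
  moreover have "Vector_Spaces.linear scaleK (*) (\<lambda>w. B w w')" for w'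
    unfolding B_def by (rule linear_lin_ext[OF r2])
  moreover have "B (embed x) (embed y) = of_rat (b x y)" for x y
    by (simp add: B_def lin_ext_embed[OF r2], simp add: g_def lin_ext_embed[OF r1])
  ultimately show "\<exists>B :: ('v, 'k) scal_ext \<Rightarrow> _ \<Rightarrow> 'k. bilinear_over scaleK B \<and>
     (\<forall>x y. B (embed x) (embed y) = of_rat (b x y))"
    unfolding bilinear_over_def by blast
next
  fix B B' :: "('v, 'k) scal_ext \<Rightarrow> ('v, 'k) scal_ext \<Rightarrow> 'k"
  assume B: "bilinear_over scaleK B \<and> (\<forall>x y. B (embed x) (embed y) = of_rat (b x y))"
    and B': "bilinear_over scaleK B' \<and> (\<forall>x y. B' (embed x) (embed y) = of_rat (b x y))"
  interpret vp: vector_space_pair "scaleK :: 'k \<Rightarrow> ('v, 'k) scal_ext \<Rightarrow> _" "(*) :: 'k \<Rightarrow> _"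
    by unfold_locales (simp_all add: algebra_simps)
  have 1: "B (embed x) w = B' (embed x) w" for x w
    by (rule vp.linear_eq_on[where B = "range embed"])
      (use B B' in \<open>auto simp: bilinear_over_def scal_ext_span_embed\<close>)
  have "B w w' = B' w w'" for w w'
    by (rule vp.linear_eq_on[where B = "range embed" and f = "\<lambda>w. B w w'" and g = "\<lambda>w. B' w w'"])
      (use B B' 1 in \<open>auto simp: bilinear_over_def scal_ext_span_embed\<close>)
  then show "B = B'" by blast
qed

text \<open>
  \<open>polar_ext\<close> and \<open>q_ext\<close> are the \<open>K\<close>-bilinear extension of the bilinear form of \<open>q\<close> and the
  corresponding extension of \<open>q\<close> (recall that the bilinear form at \<open>(x, x)\<close> is \<open>2 q(x)\<close>).
\<close>

definition polar_ext ::
  "('v::rat_vector \<Rightarrow> rat) \<Rightarrow> ('v, 'k::field_char_0) scal_ext \<Rightarrow> ('v, 'k) scal_ext \<Rightarrow> 'k" where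
  "polar_ext q = (THE B. bilinear_over scaleK B \<and>
     (\<forall>x y. B (embed x) (embed y) = of_rat (polar q x y)))"

lemma polar_ext:
  fixes q :: "'v::rat_vector \<Rightarrow> rat"
  assumes "quadratic_form q"
  shows "bilinear_over scaleK (polar_ext q :: ('v, 'k::field_char_0) scal_ext \<Rightarrow> _)"
    and "polar_ext q (embed x) (embed y) = (of_rat (polar q x y) :: 'k)"
  using theI'[OF ex1_bilinear_ext[of "polar q"]] assms
  unfolding polar_ext_def quadratic_form_def by blast+

definition q_ext ::
  "('v::rat_vector \<Rightarrow> rat) \<Rightarrow> ('v, 'k::field_char_0) scal_ext \<Rightarrow> 'k" where
  "q_ext q w = polar_ext q w w / 2"

definition has_signature :: "('v::rat_vector \<Rightarrow> rat) \<Rightarrow> nat \<Rightarrow> nat \<Rightarrow> bool" where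
  "has_signature q dp dm \<longleftrightarrow>
     (\<exists>P N :: ('v, real) scal_ext set.
        finite P \<and> finite N \<and> P \<inter> N = {} \<and> card P = dp \<and> card N = dm \<and>
        \<not> scal_ext.dependent (P \<union> N) \<and> scal_ext.span (P \<union> N) = UNIV \<and>
        (\<forall>x \<in> P \<union> N. \<forall>y \<in> P \<union> N. x \<noteq> y \<longrightarrow> polar_ext q x y = 0) \<and>
        (\<forall>x \<in> P. q_ext q x > 0) \<and> (\<forall>x \<in> N. q_ext q x < 0))"

lemma map_Im_in_span:
  assumes "p \<in> free_vs.span (tensor_relations :: ('v::rat_vector \<Rightarrow>\<^sub>0 complex) set)"
  shows "Poly_Mapping.map Im p \<in> free_vs.span (tensor_relations :: ('v \<Rightarrow>\<^sub>0 real) set)"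
  using assms
proof (induction rule: free_vs.span_induct_alt)
  case base
  have "Poly_Mapping.map Im (0 :: 'v \<Rightarrow>\<^sub>0 complex) = 0"
    by (rule poly_mapping_eqI) (simp add: lookup_map_zero)
  then show ?case by (simp add: free_vs.span_zero)
next
  case (step c r p)
  have *: "of_rat a = complex_of_real (of_rat a)" for a
    by (cases a) (simp add: of_rat_rat)
  have "\<exists>r' \<in> tensor_relations. Poly_Mapping.map Im (Poly_Mapping.map ((*) c) r)
          = Poly_Mapping.map ((*) (Im c)) r'"
    using step.hyps(1) unfolding tensor_relations_def
  proof (elim UnE rangeE, goal_cases)
    case (1 t)
    obtain x y where t: "t = (x, y)" by force
    show ?case
      by (rule bexI[of _ "Poly_Mapping.single (x + y) 1
            - Poly_Mapping.single x 1 - Poly_Mapping.single y 1"])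
        (use 1 t in \<open>auto intro!: poly_mapping_eqI
           simp: lookup_map_zero lookup_minus lookup_single when_def\<close>)
  next
    case (2 t)
    obtain a x where t: "t = (a, x)" by force
    show ?case
      by (rule bexI[of _ "Poly_Mapping.single (scaleQ a x) 1 - Poly_Mapping.single x (of_rat a)"])
        (use 2 t * in \<open>auto intro!: poly_mapping_eqI
           simp: lookup_map_zero lookup_minus lookup_single when_def\<close>)
  qed
  moreover have "Poly_Mapping.map Im (s + p) = Poly_Mapping.map Im s + Poly_Mapping.map Im p" for s
    by (rule poly_mapping_eqI) (auto simp: lookup_map_zero lookup_add when_def)
  ultimately show ?case
    using step.IH by (metis free_vs.span_add free_vs.span_scale free_vs.span_base)
qed

lift_definition Im_ext :: "('v::rat_vector, complex) scal_ext \<Rightarrow> ('v, real) scal_ext"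
  is "Poly_Mapping.map Im"
proof -
  fix p p' :: "'v \<Rightarrow>\<^sub>0 complex"
  assume "tensor_eq p p'"
  moreover have "Poly_Mapping.map Im (p - p') = Poly_Mapping.map Im p - Poly_Mapping.map Im p'"
    by (rule poly_mapping_eqI) (auto simp: lookup_map_zero lookup_minus when_def)
  ultimately show "tensor_eq (Poly_Mapping.map Im p) (Poly_Mapping.map Im p')"
    unfolding tensor_eq_def using map_Im_in_span[of "p - p'"] by simp
qed


lemma Im_ext_tensor: "Im_ext (scaleK c (embed x)) = scaleK (Im c) (embed x)"
proof -
  have "Poly_Mapping.map Im (Poly_Mapping.map ((*) c) (Poly_Mapping.single x 1))
      = Poly_Mapping.map ((*) (Im c)) (Poly_Mapping.single x 1)"
    by (rule poly_mapping_eqI) (simp add: lookup_map_zero lookup_single when_def)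
  then show ?thesis
    by (simp only: Im_ext.abs_eq scaleK.abs_eq embed.abs_eq)
qed


section \<open>The real projective space\<close>

definition proj_class :: "('v::rat_vector, real) scal_ext \<Rightarrow> ('v, real) scal_ext set" where
  "proj_class v = {scaleK c v | c. c \<noteq> 0}"

definition proj_image :: "('v::rat_vector, real) scal_ext set \<Rightarrow> ('v, real) scal_ext set set" where
  "proj_image S = proj_class ` (S - {0})"

definition proj_topology :: "('v::rat_vector, real) scal_ext set topology" where
  "proj_topology = topology (\<lambda>U. U \<subseteq> proj_image UNIV \<and>
     openin (top_of_set (UNIV - {0})) {v \<in> UNIV - {0}. proj_class v \<in> U})"

lemma openin_proj_topology:
  "openin proj_topology U \<longleftrightarrow> U \<subseteq> proj_image UNIV \<and>
     openin (top_of_set (UNIV - {0})) {v \<in> UNIV - {0}. proj_class v \<in> U}"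
proof -
  have "istopology (\<lambda>U. U \<subseteq> proj_image UNIV \<and>
     openin (top_of_set (UNIV - {0})) {v \<in> UNIV - {0::('v::rat_vector, real) scal_ext}. proj_class v \<in> U})"
    (is "istopology (\<lambda>U. U \<subseteq> _ \<and> openin ?T (?pre U))")
    unfolding istopology_def
  proof (intro conjI allI impI; (elim conjE)?)
    fix U W assume "openin ?T (?pre U)" "openin ?T (?pre W)"
    then have "openin ?T (?pre U \<inter> ?pre W)" by (rule openin_Int)
    moreover have "?pre U \<inter> ?pre W = ?pre (U \<inter> W)" by blast
    ultimately show "openin ?T (?pre (U \<inter> W))" by argo
  next
    fix \<U> :: "('v, real) scal_ext set set set"
    assume *: "\<forall>U\<in>\<U>. U \<subseteq> proj_image UNIV \<and> openin ?T (?pre U)"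
    have "?pre (\<Union>\<U>) = \<Union>(?pre ` \<U>)" by auto
    moreover have "openin ?T (\<Union>(?pre ` \<U>))"
      using * by (intro openin_Union) (simp add: image_iff Bex_def, blast)
    ultimately show "openin ?T (?pre (\<Union>\<U>))" by argo
  qed auto
  then show ?thesis
    unfolding proj_topology_def by (subst topology_inverse') simp_all
qed

definition positive_vectors :: "('v::rat_vector \<Rightarrow> rat) \<Rightarrow> ('v, real) scal_ext set" where
  "positive_vectors q = {v. q_ext q v > 0}"

definition proj_cone :: "('v::rat_vector, real) scal_ext set set \<Rightarrow> ('v, real) scal_ext set" where
  "proj_cone C = {v. v \<noteq> 0 \<and> proj_class v \<in> C}"


section \<open>Theta series\<close>

definition theta_index ::
  "('v::rat_vector, real) scal_ext set \<Rightarrow> complex \<Rightarrow> ('v, complex) scal_ext \<Rightarrow> 'v set" where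
  "theta_index S \<tau> z = {l. embed l + scaleK (1 / Im \<tau>) (Im_ext z) \<in> S}"

definition theta_term ::
  "('v::rat_vector \<Rightarrow> rat) \<Rightarrow> complex \<Rightarrow> ('v, complex) scal_ext \<Rightarrow> 'v \<Rightarrow> complex" where
  "theta_term q \<tau> z l = exp (2 * pi * \<i> * (of_rat (q l) * \<tau> + polar_ext q z (embed l)))"

definition theta ::
  "('v::rat_vector \<Rightarrow> rat) \<Rightarrow> 'v set \<Rightarrow> ('v, real) scal_ext set \<Rightarrow>
     complex \<Rightarrow> ('v, complex) scal_ext \<Rightarrow> complex" where
  "theta q L S \<tau> z = (\<Sum>\<^sub>\<infinity> l \<in> L \<inter> theta_index S \<tau> z. theta_term q \<tau> z l)"

end

theory Submission
  imports Defs
begin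

text \<open>
  With \<open>w = v / y\<close>, completing the square gives the general term the absolute value
  \<open>exp (2 \<pi> y (q w - q (l + w)))\<close>. The vectors of \<open>\<C>(C)\<close> of norm one form a compact set on which \<open>q\<close>
  is positive, so by homogeneity \<open>q u \<ge> \<epsilon> |u|\<^sup>2\<close> on \<open>\<C>(C)\<close>. Since \<open>|l + w|\<^sup>2 \<ge> |l|\<^sup>2 / 2 - |w|\<^sup>2\<close>, the
  terms are dominated on a compact set of \<open>(\<tau>, z)\<close> by a constant multiple of a fixed Gaussian
  \<open>exp (- c |l|\<^sup>2)\<close>, which is summable over the lattice, and the Weierstrass M-test applies.
\<close>

section \<open>Gaussian sums\<close>

text \<open>Since n \<le> n^2 for natural n, a geometric series of ratio \<open>exp (- c)\<close>
  dominates each of the two half-lines; their overlap in 0 is harmless.\<close>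

lemma summable_on_gaussian_int:
  fixes c :: real
  assumes "c > 0"
  shows "(\<lambda>n::int. exp (- c * (of_int n)\<^sup>2)) summable_on UNIV"
proof -
  let ?f = "\<lambda>n::int. exp (- c * (of_int n)\<^sup>2)"
  have "summable (\<lambda>n. exp (- c) ^ n)"
    by (rule summable_geometric) (use assms in simp)
  then have geo: "(\<lambda>n. exp (- c) ^ n) summable_on UNIV"
    by (rule summable_nonneg_imp_summable_on) simp
  have nat: "(\<lambda>n::nat. exp (- c * (of_nat n)\<^sup>2)) summable_on UNIV"
  proof (rule summable_on_comparison_test[OF geo])
    fix n :: nat
    have "real n \<le> (real n)\<^sup>2"
      by (cases n) (simp_all add: power2_eq_square)
    then show "exp (- c * (real n)\<^sup>2) \<le> exp (- c) ^ n"
      using assms by (simp flip: exp_of_nat_mult)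
  qed simp
  have "?f summable_on range int"
    by (subst summable_on_reindex) (use nat in \<open>simp_all add: o_def\<close>)
  moreover have "?f summable_on range (\<lambda>n. - int n)"
    by (subst summable_on_reindex) (use nat in \<open>simp_all add: o_def inj_on_def\<close>)
  moreover have "(UNIV :: int set) = range int \<union> range (\<lambda>n. - int n)"
    by (auto intro: int_cases2)
  ultimately show ?thesis
    using summable_on_union by metis
qed

text \<open>The Gaussian of a sum of squares is a product of one-variable Gaussians, so the sum over
  integer tuples indexed by \<open>B\<close> factors. Extensionality makes each tuple correspond to
  exactly one function.\<close>

lemma summable_on_gaussian_PiE:
  fixes c :: real
  assumes "c > 0" "finite B"
  shows "(\<lambda>g. exp (- c * (\<Sum>b\<in>B. (of_int (g b))\<^sup>2))) summable_on (B \<rightarrow>\<^sub>E (UNIV :: int set))"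
proof -
  have "Infinite_Set_Sum.abs_summable_on (\<lambda>n::int. exp (- c * (of_int n)\<^sup>2)) UNIV"
    using summable_on_gaussian_int[OF assms(1)] by (simp flip: abs_summable_equivalent)
  then have "Infinite_Set_Sum.abs_summable_on
      (\<lambda>g. \<Prod>b\<in>B. exp (- c * (of_int (g b))\<^sup>2)) (B \<rightarrow>\<^sub>E (UNIV :: int set))"
    by (intro abs_summable_on_prod_PiE assms) auto
  then show ?thesis
    by (simp flip: abs_summable_equivalent exp_sum[OF assms(2)]
        add: sum_distrib_left sum_negf)
qed

text \<open>Serves to clear the denominators in the coordinates of finitely many lattice
  generators.\<close>

lemma finite_rats_common_denominator:
  fixes X :: "rat set"
  assumes "finite X"
  obtains D :: int where "D > 0" "\<And>x. x \<in> X \<Longrightarrow> of_int D * x \<in> \<int>"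
proof -
  have "\<exists>D::int. D > 0 \<and> (\<forall>x\<in>X. of_int D * x \<in> \<int>)"
    using assms
  proof induction
    case empty
    show ?case by (rule exI[of _ 1]) simp
  next
    case (insert x X)
    then obtain D :: int where D: "D > 0" "\<forall>x\<in>X. of_int D * x \<in> \<int>" by blast
    obtain a b where ab: "x = of_int a / of_int b" "b > 0"
      by (cases x) (auto simp: Fract_of_int_quotient)
    have "of_int (D * b) * x = of_int (D * a)"
      using ab by simp
    then have "of_int (D * b) * x \<in> \<int>"
      by (metis Ints_of_int)
    moreover have "of_int (D * b) * y \<in> \<int>" if "y \<in> X" for y
    proof -
      have "of_int b * (of_int D * y) \<in> \<int>"
        using D(2) that by (simp add: Ints_mult)
      then show ?thesis by (simp add: mult_ac)
    qed
    ultimately show ?case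
      using D(1) ab(2) by (intro exI[of _ "D * b"]) auto
  qed
  then show ?thesis using that by blast
qed


section \<open>Extension of scalars\<close>

lemma embed_add: "embed (x + y) = embed x + embed y"
proof (transfer, unfold tensor_eq_def, rule free_vs.span_base)
  fix x y :: 'a
  have "(\<lambda>(x, y). Poly_Mapping.single (x + y) (1 :: 'b) - Poly_Mapping.single x 1
      - Poly_Mapping.single y 1) (x, y) \<in> tensor_relations"
    unfolding tensor_relations_def by (intro UnI1 rangeI)
  then show "Poly_Mapping.single (x + y) (1 :: 'b) -
      (Poly_Mapping.single x 1 + Poly_Mapping.single y 1) \<in> tensor_relations"
    by (simp add: diff_diff_eq)
qed

lemma embed_scaleQ: "embed (scaleQ a x) = scaleK (of_rat a) (embed x)"
proof (transfer, unfold tensor_eq_def, rule free_vs.span_base)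
  fix a :: rat and x :: 'a
  have "Poly_Mapping.map ((*) (of_rat a)) (Poly_Mapping.single x 1) =
      Poly_Mapping.single x (of_rat a :: 'b)"
    by (rule poly_mapping_eqI) (simp add: lookup_map_zero lookup_single when_def)
  then show "Poly_Mapping.single (scaleQ a x) 1 -
      Poly_Mapping.map ((*) (of_rat a :: 'b)) (Poly_Mapping.single x 1) \<in> tensor_relations"
    by (auto simp: tensor_relations_def)
qed

lemma embed_zero: "embed 0 = 0"
  using embed_add[of 0 0] by simp

lemma embed_sum: "embed (\<Sum>i\<in>I. f i) = (\<Sum>i\<in>I. embed (f i))"
  by (induction I rule: infinite_finite_induct) (simp_all add: embed_zero embed_add)

lemma linear_functional_sum_scale:
  assumes "Vector_Spaces.linear s (*) f"
  shows "f (\<Sum>i\<in>I. s (c i) (x i)) = (\<Sum>i\<in>I. c i * f (x i))"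
proof -
  interpret Vector_Spaces.linear s "(*)" f by fact
  show ?thesis by (simp add: sum scale)
qed

text \<open>The vectors \<open>embed x\<close> span, so a functional is determined by its values on
  them. Writing it as a \<open>lin_ext\<close> allows computing with representatives, which
  \<open>Im_lin_ext\<close> needs.\<close>

lemma linear_eq_lin_ext:
  fixes f :: "('v::rat_vector, 'k::field_char_0) scal_ext \<Rightarrow> 'k"
  assumes "Vector_Spaces.linear scaleK (*) f" "rat_linear g" "\<And>x. f (embed x) = g x"
  shows "f = lin_ext g"
proof
  fix w
  interpret vp: vector_space_pair "scaleK :: 'k \<Rightarrow> ('v, 'k) scal_ext \<Rightarrow> _" "(*) :: 'k \<Rightarrow> _"
    by unfold_locales (simp_all add: algebra_simps)
  show "f w = lin_ext g w"
    by (rule vp.linear_eq_on[where B = "range embed"])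
      (use assms in \<open>auto simp: scal_ext_span_embed linear_lin_ext lin_ext_embed\<close>)
qed

lemma Im_of_rat_mult: "Im (c * of_rat a) = Im c * of_rat a"
proof -
  have "of_rat a = complex_of_real (of_rat a)"
    by (cases a) (simp add: of_rat_rat)
  then show ?thesis by simp
qed

text \<open>\<open>Im_ext\<close> acts on the coefficients of a representative, and the values of
  \<open>g\<close> are real, so Im passes through the finite sum. The two linearity hypotheses give
  independence of the representative over the complex and the real numbers.\<close>

lemma Im_lin_ext:
  assumes "rat_linear (\<lambda>x. of_rat (g x) :: complex)" "rat_linear (\<lambda>x. of_rat (g x) :: real)"
  shows "Im (lin_ext (\<lambda>x. of_rat (g x)) z) = lin_ext (\<lambda>x. of_rat (g x)) (Im_ext z)"
proof (cases z rule: scal_ext_exhaust)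
  case (1 p)
  have "Poly_Mapping.keys (Poly_Mapping.map Im p) \<subseteq> Poly_Mapping.keys p"
    by (auto simp: in_keys_iff lookup_map_zero)
  then have "Im (free_ext (\<lambda>x. of_rat (g x)) p) =
      free_ext (\<lambda>x. of_rat (g x)) (Poly_Mapping.map Im p)"
    by (simp add: free_ext_superset[of "Poly_Mapping.keys p"] lookup_map_zero Im_of_rat_mult
        del: times_complex.sel)
  then show ?thesis
    by (simp add: 1 Im_ext.abs_eq lin_ext_abs assms)
qed

section \<open>Continuity for the initial topology\<close>

lemma continuous_on_linear_functional:
  fixes f :: "('v::rat_vector, 'k::{field_char_0, topological_space}) scal_ext \<Rightarrow> 'k"
  assumes "Vector_Spaces.linear scaleK (*) f"
  shows "continuous_on A f"
proof -
  have "open (f -` U)" if "open U" for U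
    unfolding open_scal_ext_def using assms that by (intro generate_topology.Basis) blast
  then have "continuous_on UNIV f"
    by (simp add: continuous_on_open_vimage)
  then show ?thesis
    by (rule continuous_on_subset) simp
qed

lemma continuous_on_scal_extI:
  fixes g :: "'a::topological_space \<Rightarrow> ('v::rat_vector, 'k::{field_char_0, topological_space}) scal_ext"
  assumes "\<And>f. Vector_Spaces.linear scaleK (*) f \<Longrightarrow> continuous_on A (\<lambda>x. f (g x))"
  shows "continuous_on A g"
proof (rule continuous_on_generate_topology)
  show "open = generate_topology
      {f -` U | f U. Vector_Spaces.linear scaleK (*) (f :: ('v, 'k) scal_ext \<Rightarrow> 'k) \<and> open U}"
    by (rule open_scal_ext_def)
next
  fix B :: "('v, 'k) scal_ext set"
  assume "B \<in> {f -` U | f U. Vector_Spaces.linear scaleK (*) f \<and> open U}"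
  then obtain f U where "B = f -` U" "Vector_Spaces.linear scaleK (*) f" "open U"
    by blast
  moreover from this obtain V where "open V" "V \<inter> A = (\<lambda>x. f (g x)) -` U \<inter> A"
    using assms unfolding continuous_on_open_invariant by blast
  ultimately show "\<exists>C. open C \<and> C \<inter> A = g -` B \<inter> A"
    by auto
qed

section \<open>The extended quadratic form\<close>

context
  fixes q :: "'v::rat_vector \<Rightarrow> rat"
  assumes q: "quadratic_form q"
begin

lemma polar_ext_linear:
  shows "Vector_Spaces.linear scaleK (*) (\<lambda>y. polar_ext q x y :: 'k::field_char_0)"
    and "Vector_Spaces.linear scaleK (*) (\<lambda>x. polar_ext q x y :: 'k::field_char_0)"
  using polar_ext(1)[OF q, where ?'k = 'k] by (simp_all add: bilinear_over_def)

lemma rat_linear_polar: "rat_linear (\<lambda>x. of_rat (polar q x l) :: 'k::field_char_0)"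
proof -
  have "Vector_Spaces.linear scaleQ (*) (\<lambda>x. polar q x l)"
    using q by (simp add: quadratic_form_def bilinear_over_def)
  from linearD[OF this] show ?thesis
    by (simp add: rat_linear_def of_rat_add of_rat_mult)
qed

lemma polar_ext_embed_eq_lin_ext:
  "(\<lambda>w. polar_ext q w (embed l) :: 'k::field_char_0) = lin_ext (\<lambda>x. of_rat (polar q x l))"
  by (rule linear_eq_lin_ext[OF polar_ext_linear(2) rat_linear_polar]) (rule polar_ext(2)[OF q])

lemma Im_polar_ext: "Im (polar_ext q z (embed l)) = polar_ext q (Im_ext z) (embed l)"
  using Im_lin_ext[OF rat_linear_polar rat_linear_polar, of l z]
    fun_cong[OF polar_ext_embed_eq_lin_ext, of z l]
    fun_cong[OF polar_ext_embed_eq_lin_ext, of "Im_ext z" l]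
  by simp

text \<open>Symmetry is visible on embedded vectors and is carried to the whole space one argument
  at a time, by linearity.\<close>

lemma polar_ext_commute: "polar_ext q v w = (polar_ext q w v :: 'k::field_char_0)"
proof -
  interpret vp: vector_space_pair "scaleK :: 'k \<Rightarrow> ('v, 'k) scal_ext \<Rightarrow> _" "(*) :: 'k \<Rightarrow> _"
    by unfold_locales (simp_all add: algebra_simps)
  have 1: "polar_ext q w (embed l) = (polar_ext q (embed l) w :: 'k)" for l w
    by (rule vp.linear_eq_on[where B = "range embed" and f = "\<lambda>w. polar_ext q w (embed l)"
          and g = "polar_ext q (embed l)"])
      (auto simp: polar_ext_linear scal_ext_span_embed polar_ext(2)[OF q] polar_def add.commute)
  show ?thesis
    by (rule vp.linear_eq_on[where B = "range embed" and f = "\<lambda>w. polar_ext q v w"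
          and g = "\<lambda>w. polar_ext q w v"])
      (auto simp: polar_ext_linear scal_ext_span_embed 1)
qed

lemma q_ext_scaleK: "q_ext q (scaleK c w) = c\<^sup>2 * q_ext q w"
  by (simp add: q_ext_def linearD(2)[OF polar_ext_linear(1)] linearD(2)[OF polar_ext_linear(2)]
      power2_eq_square)

lemma q_ext_add: "q_ext q (v + w) = q_ext q v + polar_ext q w v + q_ext q w"
  by (simp add: q_ext_def linearD(1)[OF polar_ext_linear(1)] linearD(1)[OF polar_ext_linear(2)]
      polar_ext_commute[of v w] field_simps)

text \<open>Homogeneity gives q(2l) = 4 q(l), hence \<open>polar q l l = 2 * q l\<close>, and the
  division by 2 in \<open>q_ext\<close> cancels the factor.\<close>

lemma q_ext_embed: "q_ext q (embed l) = of_rat (q l)"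
proof -
  have "q (scaleQ 2 l) = 4 * q l"
    using q by (simp add: quadratic_form_def)
  moreover have "scaleQ 2 l = l + l"
    using scaleQ_add_left[of 1 1 l] by (simp add: scaleQ_one)
  ultimately have "polar q l l = 2 * q l"
    by (simp add: polar_def)
  then show ?thesis
    by (simp add: q_ext_def polar_ext(2)[OF q] of_rat_mult)
qed

end

section \<open>Coordinates and a Euclidean norm from a rational basis\<close>

locale rational_basis =
  fixes B :: "'v::rat_vector set"
  assumes finite_basis: "finite B"
    and independent_basis: "rat_vector.independent B"
    and span_basis: "rat_vector.span B = UNIV"
begin

text \<open>One rational basis provides coordinates over every K at once, so that lattice vectors,
  real vectors and complex vectors are compared in the same coordinates.\<close>

definition coord :: "'v \<Rightarrow> ('v, 'k::field_char_0) scal_ext \<Rightarrow> 'k" where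
  "coord b = lin_ext (\<lambda>x. of_rat (rat_vector.representation B x b))"

text \<open>A positive definite form, chosen independently of q, to measure the size of vectors when
  q is indefinite.\<close>

definition sqnorm :: "('v, real) scal_ext \<Rightarrow> real" where
  "sqnorm w = (\<Sum>b\<in>B. (coord b w)\<^sup>2)"

lemma rat_linear_representation:
  "rat_linear (\<lambda>x. of_rat (rat_vector.representation B x b) :: 'k::field_char_0)"
  by (simp add: rat_linear_def rat_vector.representation_add rat_vector.representation_scale
      independent_basis span_basis of_rat_add of_rat_mult)

lemma linear_coord: "Vector_Spaces.linear scaleK (*) (coord b)"
  unfolding coord_def by (rule linear_lin_ext[OF rat_linear_representation])

lemma coord_embed: "coord b (embed x) = of_rat (rat_vector.representation B x b)"
  unfolding coord_def by (rule lin_ext_embed[OF rat_linear_representation])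

lemma coord_Im_ext: "coord b (Im_ext z) = Im (coord b z)"
  unfolding coord_def by (rule Im_lin_ext[symmetric]) (rule rat_linear_representation)+

lemma coord_zero: "coord b 0 = 0"
  using linearD(2)[OF linear_coord, of b 0 0] by simp

text \<open>Both sides are linear in \<open>w\<close>, and for \<open>w = embed y\<close> the
  identity is the embedded basis expansion of \<open>y\<close>.\<close>

lemma sum_coord: "(\<Sum>b\<in>B. scaleK (coord b w) (embed b)) = w"
proof -
  have "w \<in> scal_ext.span (range embed)"
    by (simp add: scal_ext_span_embed)
  then show ?thesis
  proof (induction rule: scal_ext.span_induct_alt)
    case base
    show ?case
      by (simp add: coord_zero)
  next
    case (step c x w)
    then obtain y where x: "x = embed y" by blast
    have "(\<Sum>b\<in>B. scaleK (coord b (embed y)) (embed b)) =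
        embed (\<Sum>b\<in>B. scaleQ (rat_vector.representation B y b) b)"
      by (simp add: coord_embed embed_sum embed_scaleQ)
    also have "\<dots> = embed y"
      by (subst rat_vector.sum_representation_eq)
        (simp_all add: independent_basis span_basis finite_basis)
    finally have "(\<Sum>b\<in>B. scaleK (coord b x) (embed b)) = x"
      by (simp add: x)
    then have "(\<Sum>b\<in>B. scaleK (c * coord b x) (embed b)) = scaleK c x"
      by (simp flip: scal_ext.scale_scale scal_ext.scale_sum_right)
    then show ?case
      using step by (simp add: linearD[OF linear_coord] scal_ext.scale_left_distrib sum.distrib)
  qed
qed

lemma linear_functional_coord:
  assumes "Vector_Spaces.linear scaleK (*) f"
  shows "f w = (\<Sum>b\<in>B. coord b w * f (embed b))"
  by (subst (1) sum_coord[of w, symmetric]) (rule linear_functional_sum_scale[OF assms])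

lemma continuous_on_sqnorm: "continuous_on A sqnorm"
  unfolding sqnorm_def
  by (intro continuous_intros continuous_on_linear_functional linear_coord)

text \<open>Expanding one argument of the bilinear form in coordinates leaves a finite sum of
  products of linear functionals, each continuous in the initial topology.\<close>

lemma continuous_on_q_ext:
  fixes q :: "'v \<Rightarrow> rat"
  assumes "quadratic_form q"
  shows "continuous_on A (q_ext q :: ('v, real) scal_ext \<Rightarrow> real)"
proof -
  have "q_ext q = (\<lambda>w. (\<Sum>b\<in>B. coord b w * polar_ext q w (embed b)) / 2 :: real)"
    unfolding q_ext_def by (rule ext) (metis linear_functional_coord[OF polar_ext_linear(1)[OF assms]])
  moreover have "continuous_on A \<dots>"
    by (intro continuous_intros continuous_on_linear_functional linear_coord
        polar_ext_linear(2)[OF assms]) simp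
  ultimately show ?thesis by argo
qed

lemma continuous_on_Im_ext: "continuous_on (A :: ('v, complex) scal_ext set) Im_ext"
proof (rule continuous_on_scal_extI)
  fix f :: "('v, real) scal_ext \<Rightarrow> real"
  assume f: "Vector_Spaces.linear scaleK (*) f"
  have "(\<lambda>z. f (Im_ext z)) = (\<lambda>z. \<Sum>b\<in>B. Im (coord b z) * f (embed b))"
    by (subst linear_functional_coord[OF f]) (simp add: coord_Im_ext)
  moreover have "continuous_on A \<dots>"
    by (intro continuous_intros continuous_on_linear_functional linear_coord)
  ultimately show "continuous_on A (\<lambda>z. f (Im_ext z))" by argo
qed

lemma sqnorm_nonneg: "sqnorm w \<ge> 0"
  by (simp add: sqnorm_def sum_nonneg)

lemma sqnorm_scaleK: "sqnorm (scaleK c w) = c\<^sup>2 * sqnorm w"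
  by (simp add: sqnorm_def linearD(2)[OF linear_coord] power_mult_distrib sum_distrib_left)

lemma sqnorm_eq_0_iff: "sqnorm w = 0 \<longleftrightarrow> w = 0"
proof
  assume "sqnorm w = 0"
  then have "\<forall>b\<in>B. coord b w = 0"
    by (simp add: sqnorm_def sum_nonneg_eq_0_iff finite_basis)
  then show "w = 0"
    by (subst sum_coord[of w, symmetric]) simp
next
  assume "w = 0"
  then show "sqnorm w = 0"
    using sqnorm_scaleK[of 0 0] by simp
qed

lemma sqnorm_add_ge: "sqnorm (v + w) \<ge> sqnorm v / 2 - sqnorm w"
proof -
  \<comment> \<open>The difference of the two sides is
    \<open>(a + 2 * b)\<^sup>2 / 2\<close>.\<close>
  have *: "(a + b)\<^sup>2 \<ge> a\<^sup>2 / 2 - b\<^sup>2" for a b :: real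
    using zero_le_power2[of "a + 2 * b"] by (simp add: power2_eq_square algebra_simps)
  have "sqnorm v / 2 - sqnorm w = (\<Sum>b\<in>B. (coord b v)\<^sup>2 / 2 - (coord b w)\<^sup>2)"
    by (simp add: sqnorm_def sum_subtractf sum_divide_distrib)
  also have "\<dots> \<le> sqnorm (v + w)"
    unfolding sqnorm_def linearD(1)[OF linear_coord] by (intro sum_mono *)
  finally show ?thesis .
qed

section \<open>Compactness, and positivity of q on the cone\<close>

lemma compact_unit_sphere: "compact {w. sqnorm w = 1}"
proof -
  define \<Phi> :: "('v \<Rightarrow> real) \<Rightarrow> ('v, real) scal_ext" where
    "\<Phi> a = (\<Sum>b\<in>B. scaleK (a b) (embed b))" for a
  \<comment> \<open>The cube has a factor for every vector of V, so it lives in the full function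
    type and is compact by Tychonoff; \<open>\<Phi>\<close> ignores the factors outside
    \<open>B\<close>. The sphere is a closed part of its compact image.\<close>
  define Q :: "('v \<Rightarrow> real) set" where "Q = (\<Pi>\<^sub>E b\<in>UNIV. {-1..1})"
  have "compact Q"
    using compactin_PiE[of "\<lambda>_. euclidean" UNIV "\<lambda>_::'v. {-1..1::real}"]
    by (simp add: Q_def euclidean_product_topology)
  have cont: "continuous_on A (\<lambda>a. a b)" for A :: "('v \<Rightarrow> real) set" and b
    by (rule continuous_on_subset[OF continuous_on_product_coordinates]) simp
  have "continuous_on Q \<Phi>"
  proof (rule continuous_on_scal_extI)
    fix f :: "('v, real) scal_ext \<Rightarrow> real"
    assume f: "Vector_Spaces.linear scaleK (*) f"
    show "continuous_on Q (\<lambda>a. f (\<Phi> a))"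
      unfolding \<Phi>_def linear_functional_sum_scale[OF f]
      by (intro continuous_intros cont)
  qed
  then have "compact (\<Phi> ` Q)"
    using \<open>compact Q\<close> by (rule compact_continuous_image)
  moreover have "closed (sqnorm -` {1})"
    using continuous_on_sqnorm by (intro closed_vimage) auto
  ultimately have "compact (\<Phi> ` Q \<inter> sqnorm -` {1})"
    by (rule compact_Int_closed)
  moreover have "w \<in> \<Phi> ` Q" if "sqnorm w = 1" for w
  proof
    \<comment> \<open>The value 0 off \<open>B\<close> keeps the point inside the cube without
      affecting \<open>\<Phi>\<close>.\<close>
    let ?a = "\<lambda>b. if b \<in> B then coord b w else 0"
    show "w = \<Phi> ?a"
      by (simp add: \<Phi>_def sum_coord)
    have "\<bar>coord b w\<bar> \<le> 1" if "b \<in> B" for b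
    proof -
      have "(coord b w)\<^sup>2 \<le> sqnorm w"
        unfolding sqnorm_def using that by (intro member_le_sum) (simp_all add: finite_basis)
      then show ?thesis
        using \<open>sqnorm w = 1\<close> by (simp add: abs_square_le_1)
    qed
    then show "?a \<in> Q"
      by (auto simp: Q_def abs_le_iff)
  qed
  then have "\<Phi> ` Q \<inter> sqnorm -` {1} = {w. sqnorm w = 1}"
    by auto
  ultimately show ?thesis by simp
qed

lemma q_ext_ge_sqnorm_on_proj_cone:
  fixes q :: "'v \<Rightarrow> rat"
  assumes q: "quadratic_form q"
    and C: "C \<subseteq> proj_image (positive_vectors q)" "closedin proj_topology C"
  obtains \<epsilon> where "\<epsilon> > 0" "\<And>w. w \<in> proj_cone C \<Longrightarrow> q_ext q w \<ge> \<epsilon> * sqnorm w"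
proof -
  define T where "T = {w. sqnorm w = 1} \<inter> proj_cone C"
  have topspace: "topspace (proj_topology :: ('v, real) scal_ext set topology) = proj_image UNIV"
  proof
    have "{v \<in> UNIV - {0}. proj_class v \<in> proj_image UNIV} = UNIV - {0 :: ('v, real) scal_ext}"
      by (auto simp: proj_image_def)
    then have "openin proj_topology (proj_image UNIV :: ('v, real) scal_ext set set)"
      unfolding openin_proj_topology by simp
    then show "proj_image UNIV \<subseteq> topspace (proj_topology :: ('v, real) scal_ext set topology)"
      by (rule openin_subset)
  qed (metis openin_proj_topology openin_topspace)
  \<comment> \<open>By the quotient topology, the nonzero vectors with class outside
    \<open>C\<close> are cut out by an open set \<open>U\<close> of V(R). So \<open>T\<close> is the
    unit sphere minus \<open>U\<close>, hence compact.\<close>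
  have "openin proj_topology (proj_image UNIV - C)"
    using C(2) by (simp add: closedin_def topspace)
  then obtain U where U: "open U"
    "{v \<in> UNIV - {0}. proj_class v \<in> proj_image UNIV - C} = (UNIV - {0}) \<inter> U"
    unfolding openin_proj_topology openin_open by blast
  have U_iff: "v \<in> U \<longleftrightarrow> proj_class v \<notin> C" if "v \<noteq> 0" for v
  proof -
    have "proj_class v \<in> proj_image UNIV"
      using that by (simp add: proj_image_def)
    then show ?thesis
      using U(2) that by blast
  qed
  have "T = {w. sqnorm w = 1} - U"
  proof -
    have "w \<noteq> 0" if "sqnorm w = 1" for w
      using that sqnorm_eq_0_iff[of w] by auto
    then show ?thesis
      unfolding T_def proj_cone_def using U_iff by blast
  qed
  then have "compact T"
    using compact_diff[OF compact_unit_sphere U(1)] by simp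
  \<comment> \<open>The hypothesis on \<open>C\<close> yields only some positive representative of
    the class; any other one differs by a scalar c, which multiplies q by c^2 > 0.\<close>
  have pos: "q_ext q w > 0" if w: "w \<in> proj_cone C" for w
  proof -
    from w C(1) obtain p where p: "proj_class w = proj_class p" "q_ext q p > 0"
      unfolding proj_cone_def proj_image_def positive_vectors_def by auto
    have "w \<in> proj_class w"
      unfolding proj_class_def by (auto intro!: exI[of _ 1])
    then obtain c where "c \<noteq> 0" "w = scaleK c p"
      unfolding p(1) by (auto simp: proj_class_def)
    then show ?thesis
      using p(2) by (simp add: q_ext_scaleK[OF q])
  qed
  obtain \<epsilon> where \<epsilon>: "\<epsilon> > 0" "\<And>w. w \<in> T \<Longrightarrow> q_ext q w \<ge> \<epsilon>"
  proof (cases "T = {}")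
    case True
    then show ?thesis using that[of 1] by simp
  next
    case False
    then obtain w where "w \<in> T" "\<forall>w'\<in>T. q_ext q w \<le> q_ext q w'"
      using continuous_attains_inf[OF \<open>compact T\<close> False continuous_on_q_ext[OF q]] by blast
    then show ?thesis
      using pos by (intro that[of "q_ext q w"]) (auto simp: T_def)
  qed
  show ?thesis
  proof (rule that[OF \<epsilon>(1)])
    fix w assume w: "w \<in> proj_cone C"
    \<comment> \<open>Normalizing \<open>w\<close> keeps its class, hence lands in \<open>T\<close>;
      q and \<open>sqnorm\<close> both scale by c^2, so the bound on \<open>T\<close> transfers back
      to \<open>w\<close>.\<close>
    define c where "c = 1 / sqrt (sqnorm w)"
    have n: "sqnorm w > 0"
      using w sqnorm_nonneg[of w] sqnorm_eq_0_iff[of w] by (simp add: proj_cone_def)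
    then have c: "c \<noteq> 0" "c\<^sup>2 = 1 / sqnorm w"
      by (simp_all add: c_def power_divide)
    have "proj_class (scaleK c w) = proj_class w"
    proof -
      have "\<exists>d'. d' \<noteq> 0 \<and> scaleK d w = scaleK d' (scaleK c w)" if "d \<noteq> 0" for d
        using c(1) that by (intro exI[of _ "d / c"]) simp
      moreover have "\<exists>d'. d' \<noteq> 0 \<and> scaleK d (scaleK c w) = scaleK d' w" if "d \<noteq> 0" for d
        using c(1) that by (intro exI[of _ "d * c"]) simp
      ultimately show ?thesis
        unfolding proj_class_def by blast
    qed
    then have "scaleK c w \<in> T"
      using w c n by (simp add: T_def proj_cone_def sqnorm_scaleK)
    from \<epsilon>(2)[OF this] show "q_ext q w \<ge> \<epsilon> * sqnorm w"
      using n c by (simp add: q_ext_scaleK[OF q] field_simps)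
  qed
qed

section \<open>Gaussian sums over the lattice\<close>

lemma lattice_common_denominator:
  assumes "is_lattice L"
  obtains D :: int where "D > 0"
    "\<And>l b. l \<in> L \<Longrightarrow> of_int D * rat_vector.representation B l b \<in> \<int>"
proof -
  obtain S where S: "finite S" "L = int_module.span S"
    using assms by (auto simp: is_lattice_def)
  \<comment> \<open>It is enough to clear denominators for generators and basis vectors: coordinates
    off \<open>B\<close> vanish, and integrality passes to integer combinations.\<close>
  obtain D :: int where D: "D > 0"
    "\<And>x. x \<in> (\<lambda>(s, b). rat_vector.representation B s b) ` (S \<times> B) \<Longrightarrow> of_int D * x \<in> \<int>"
    using finite_rats_common_denominator[OF finite_imageI[OF finite_cartesian_product[OF S(1) finite_basis]]]
    by metis
  have "of_int D * rat_vector.representation B l b \<in> \<int>" if "l \<in> L" for l b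
    using that unfolding S(2)
  proof (induction rule: int_module.span_induct_alt)
    case base
    show ?case by (simp add: rat_vector.representation_zero)
  next
    case (step n s l)
    have "of_int D * rat_vector.representation B s b \<in> \<int>"
    proof (cases "b \<in> B")
      case True
      then show ?thesis using D(2) step(1) by force
    next
      case False
      then have "rat_vector.representation B s b = 0"
        using rat_vector.representation_ne_zero by blast
      then show ?thesis by simp
    qed
    then have "of_int n * (of_int D * rat_vector.representation B s b) \<in> \<int>"
      by simp
    then show ?case
      using Ints_add[OF _ step(2)]
      by (simp add: rat_vector.representation_add rat_vector.representation_scale
          independent_basis span_basis algebra_simps)
  qed
  then show ?thesis using that D(1) by blast
qed

text \<open>Coordinates multiplied by a common denominator D embed the lattice into the integer
  tuples indexed by \<open>B\<close>, and \<open>sqnorm\<close> becomes the sum of squares divided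
  by D^2. The sum is thus part of a Gaussian sum over tuples.\<close>

lemma summable_on_gaussian_lattice:
  assumes "is_lattice L" "c > 0"
  shows "(\<lambda>l. exp (- c * sqnorm (embed l))) summable_on L"
proof -
  obtain D :: int where D: "D > 0"
    "\<And>l b. l \<in> L \<Longrightarrow> of_int D * rat_vector.representation B l b \<in> \<int>"
    using lattice_common_denominator[OF assms(1)] by blast
  \<comment> \<open>On \<open>L\<close> the argument of the floor is already an integer, so the
    floor only changes its type.\<close>
  define \<phi> where "\<phi> l = (\<lambda>b\<in>B. \<lfloor>of_int D * rat_vector.representation B l b\<rfloor>)" for l
  have \<phi>: "of_int (\<phi> l b) = of_int D * rat_vector.representation B l b" if "l \<in> L" "b \<in> B" for l b
    using D(2)[OF that(1), of b] that(2) by (simp add: \<phi>_def)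
  have "inj_on \<phi> L"
  proof (rule inj_onI)
    fix l l' assume l: "l \<in> L" "l' \<in> L" "\<phi> l = \<phi> l'"
    have "rat_vector.representation B l b = rat_vector.representation B l' b" if "b \<in> B" for b
      using \<phi>[OF l(1) that] \<phi>[OF l(2) that] l(3) D(1) by simp
    then have "(\<Sum>b\<in>B. scaleQ (rat_vector.representation B l b) b) =
        (\<Sum>b\<in>B. scaleQ (rat_vector.representation B l' b) b)"
      by simp
    then show "l = l'"
      by (simp add: rat_vector.sum_representation_eq independent_basis span_basis finite_basis)
  qed
  have coord: "coord b (embed l) = real_of_int (\<phi> l b) / of_int D" if "l \<in> L" "b \<in> B" for l b
    using arg_cong[OF \<phi>[OF that], of real_of_rat] D(1)
    by (simp add: coord_embed of_rat_mult field_simps)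
  let ?c = "c / (of_int D)\<^sup>2"
  have "(\<lambda>g. exp (- ?c * (\<Sum>b\<in>B. (of_int (g b))\<^sup>2))) summable_on (\<phi> ` L)"
    by (rule summable_on_subset_banach[OF summable_on_gaussian_PiE])
      (use assms(2) D(1) in \<open>auto simp: finite_basis \<phi>_def\<close>)
  then have "(\<lambda>l. exp (- ?c * (\<Sum>b\<in>B. (of_int (\<phi> l b))\<^sup>2))) summable_on L"
    by (simp add: summable_on_reindex[OF \<open>inj_on \<phi> L\<close>] o_def)
  then show ?thesis
    by (rule summable_on_cong[THEN iffD1, rotated])
      (simp add: sqnorm_def coord power_divide sum_divide_distrib[symmetric])
qed

end


section \<open>Convergence of the theta series\<close>

text \<open>Only the imaginary part y (q(l) + <w,l>) of the bracket matters, and it becomes y (q(l +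
  w) - q(w)). Here \<open>w\<close> is the shift from \<open>theta_index\<close>, so the cone
  condition applies directly to \<open>embed l + w\<close>.\<close>

lemma norm_theta_term:
  fixes q :: "'v::rat_vector \<Rightarrow> rat" and z :: "('v, complex) scal_ext"
  assumes q: "quadratic_form q" and y: "Im \<tau> > 0"
  defines "w \<equiv> scaleK (1 / Im \<tau>) (Im_ext z)"
  shows "norm (theta_term q \<tau> z l) =
    exp (2 * pi * Im \<tau> * (q_ext q w - q_ext q (embed l + w)))"
proof -
  have "Im_ext z = scaleK (Im \<tau>) w"
    using y by (simp add: w_def)
  then have "polar_ext q (Im_ext z) (embed l) = Im \<tau> * polar_ext q w (embed l)"
    by (simp add: linearD(2)[OF polar_ext_linear(2)[OF q]])
  moreover have "Im (of_rat (q l) * \<tau>) = of_rat (q l) * Im \<tau>"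
    using Im_of_rat_mult[of \<tau> "q l"] by (simp add: mult.commute)
  ultimately have "Im (of_rat (q l) * \<tau> + polar_ext q z (embed l)) =
      Im \<tau> * (of_rat (q l) + polar_ext q w (embed l))"
    by (simp add: Im_polar_ext[OF q] algebra_simps)
  also have "\<dots> = Im \<tau> * (q_ext q (embed l + w) - q_ext q w)"
    by (simp add: q_ext_add[OF q] q_ext_embed[OF q])
  finally have "Im (of_rat (q l) * \<tau> + polar_ext q z (embed l)) =
      Im \<tau> * (q_ext q (embed l + w) - q_ext q w)" .
  moreover have "Re (2 * pi * \<i> * s) = - (2 * pi * Im s)" for s
    by simp
  ultimately show ?thesis
    unfolding theta_term_def norm_exp_eq_Re by (simp only:) (simp add: algebra_simps)
qed

text \<open>The index set varies with (tau, z), so uniformity is expressed along the net of finite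
  subsets F of \<open>L\<close>, each partial sum using the indices in F admissible at the given
  point.\<close>

theorem theorem2p1:
  fixes q :: "'v::rat_vector \<Rightarrow> rat"
    and dp dm :: nat
    and L :: "'v set"
    and C :: "('v, real) scal_ext set set"
    and K :: "(complex \<times> ('v, complex) scal_ext) set"
  assumes "\<exists>B :: 'v set. finite B \<and> rat_vector.span B = UNIV"
    and "quadratic_form q" and "nondegenerate q" and "has_signature q dp dm"
    and "is_lattice L"
    and "C \<subseteq> proj_image (positive_vectors q)" and "closedin proj_topology C"
    and "compact K" and "K \<subseteq> {\<tau>. Im \<tau> > 0} \<times> UNIV"
  shows "(\<forall>(\<tau>, z) \<in> K.
      (\<lambda>l. norm (theta_term q \<tau> z l)) summable_on (L \<inter> theta_index (proj_cone C) \<tau> z)) \<and>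
    uniform_limit K
      (\<lambda>F (\<tau>, z). \<Sum>l \<in> F \<inter> theta_index (proj_cone C) \<tau> z. theta_term q \<tau> z l)
      (\<lambda>(\<tau>, z). theta q L (proj_cone C) \<tau> z)
      (finite_subsets_at_top L)"
\<comment> \<open>The extrema over \<open>K\<close> taken below require a point of
  \<open>K\<close>.\<close>
proof (cases "K = {}")
  case True
  then show ?thesis
    by (simp add: uniform_limit_iff)
next
  case False
  note q = assms(2)
  have Im_pos: "Im \<tau> > 0" if "(\<tau>, z) \<in> K" for \<tau> z
    using that assms(9) by auto
  obtain S where S: "finite S" "rat_vector.span S = (UNIV :: 'v set)"
    using assms(1) by blast
  obtain B where "B \<subseteq> S" "rat_vector.independent B" "S \<subseteq> rat_vector.span B"
    using rat_vector.maximal_independent_subset by blast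
  moreover from this have "rat_vector.span B = UNIV"
    using S(2) rat_vector.span_mono[of S "rat_vector.span B"] by (auto simp: rat_vector.span_span)
  ultimately interpret rational_basis B
    using S(1) finite_subset by unfold_locales auto
  obtain \<epsilon> where \<epsilon>: "\<epsilon> > 0" "\<And>w. w \<in> proj_cone C \<Longrightarrow> q_ext q w \<ge> \<epsilon> * sqnorm w"
    using q_ext_ge_sqnorm_on_proj_cone[OF q assms(6,7)] by blast
  define W :: "complex \<times> ('v, complex) scal_ext \<Rightarrow> ('v, real) scal_ext" where
    "W = (\<lambda>(\<tau>, z). scaleK (1 / Im \<tau>) (Im_ext z))"
  \<comment> \<open>The part of the exponent bound that does not involve \<open>l\<close>; its
    maximum over \<open>K\<close> provides the constant factor of the majorant.\<close>
  define h where "h p = 2 * pi * Im (fst p) * (q_ext q (W p) + \<epsilon> * sqnorm (W p))" for p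
  have "continuous_on K W"
  proof (rule continuous_on_scal_extI)
    fix f :: "('v, real) scal_ext \<Rightarrow> real"
    assume f: "Vector_Spaces.linear scaleK (*) f"
    have "continuous_on K (\<lambda>p. 1 / Im (fst p) * f (Im_ext (snd p)))"
    proof (intro continuous_intros)
      show "\<forall>p\<in>K. Im (fst p) \<noteq> 0"
        using Im_pos by fastforce
      show "continuous_on K (\<lambda>p. f (Im_ext (snd p)))"
        by (intro continuous_on_compose2[OF continuous_on_linear_functional[OF f, of UNIV]]
            continuous_on_compose2[OF continuous_on_Im_ext[of UNIV]] continuous_intros) auto
    qed
    then show "continuous_on K (\<lambda>p. f (W p))"
      by (simp add: W_def case_prod_unfold linearD(2)[OF f])
  qed
  then have "continuous_on K h"
    unfolding h_def
    by (intro continuous_intros continuous_on_compose2[OF continuous_on_q_ext[OF q, of UNIV]]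
        continuous_on_compose2[OF continuous_on_sqnorm[of UNIV]]) auto
  then obtain p1 where p1: "\<And>p. p \<in> K \<Longrightarrow> h p \<le> h p1"
    using continuous_attains_sup[OF assms(8) False] by blast
  have "continuous_on K (\<lambda>p. Im (fst p))"
    by (intro continuous_intros)
  then obtain p0 where p0: "p0 \<in> K" "\<And>p. p \<in> K \<Longrightarrow> Im (fst p0) \<le> Im (fst p)"
    using continuous_attains_inf[OF assms(8) False] by blast
  \<comment> \<open>The factor 2 pi y is halved by \<open>sqnorm_add_ge\<close>, and y is replaced
    by its minimum over \<open>K\<close>.\<close>
  define c where "c = pi * Im (fst p0) * \<epsilon>"
  have "c > 0"
    using Im_pos[of "fst p0" "snd p0"] p0(1) \<epsilon>(1) by (simp add: c_def)
  define M where "M l = exp (h p1) * exp (- c * sqnorm (embed l))" for l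
  have M: "M summable_on L"
    unfolding M_def by (intro summable_on_cmult_right summable_on_gaussian_lattice assms(5) \<open>c > 0\<close>)
  have bound: "norm (theta_term q \<tau> z l) \<le> M l"
    if "(\<tau>, z) \<in> K" "l \<in> theta_index (proj_cone C) \<tau> z" for \<tau> z l
  proof -
    let ?w = "W (\<tau>, z)" and ?y = "Im \<tau>"
    have y: "?y > 0" "?y \<ge> Im (fst p0)"
      using Im_pos p0(2) that(1) by force+
    have "\<epsilon> * (sqnorm (embed l) / 2 - sqnorm ?w) \<le> \<epsilon> * sqnorm (embed l + ?w)"
      using sqnorm_add_ge \<epsilon>(1) by simp
    also have "\<dots> \<le> q_ext q (embed l + ?w)"
      using that(2) by (intro \<epsilon>(2)) (simp add: theta_index_def W_def)
    finally have "2 * pi * ?y * (q_ext q ?w - q_ext q (embed l + ?w)) \<le>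
        2 * pi * ?y * (q_ext q ?w - \<epsilon> * (sqnorm (embed l) / 2 - sqnorm ?w))"
      using y(1) by (intro mult_left_mono) auto
    also have "\<dots> = h (\<tau>, z) - pi * ?y * \<epsilon> * sqnorm (embed l)"
      by (simp add: h_def algebra_simps)
    also have "\<dots> \<le> h p1 - c * sqnorm (embed l)"
      using p1[OF that(1)] y \<epsilon>(1) sqnorm_nonneg
      by (intro diff_mono) (auto simp: c_def intro!: mult_right_mono mult_left_mono)
    finally show ?thesis
      by (simp add: norm_theta_term[OF q y(1)] W_def M_def flip: exp_add)
  qed
  \<comment> \<open>Extending the terms by zero gives every point of \<open>K\<close> the same index
    set \<open>L\<close>, as the M-test requires.\<close>
  define f where "f l = (\<lambda>(\<tau>, z). if l \<in> theta_index (proj_cone C) \<tau> z then theta_term q \<tau> z l else 0)" for l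
  have "uniform_limit K (\<lambda>F p. \<Sum>l\<in>F. f l p) (\<lambda>p. \<Sum>\<^sub>\<infinity>l\<in>L. f l p) (finite_subsets_at_top L)"
    by (rule Weierstrass_m_test_general[OF _ M]) (use bound in \<open>auto simp: f_def M_def\<close>)
  moreover have "(\<lambda>p. \<Sum>\<^sub>\<infinity>l\<in>L. f l p) = (\<lambda>(\<tau>, z). theta q L (proj_cone C) \<tau> z)"
    by (auto simp: theta_def f_def fun_eq_iff intro!: infsum_cong_neutral split: if_splits)
  moreover have "\<forall>\<^sub>F F in finite_subsets_at_top L. \<forall>p\<in>K. (\<Sum>l\<in>F. f l p) =
      (case p of (\<tau>, z) \<Rightarrow> \<Sum>l \<in> F \<inter> theta_index (proj_cone C) \<tau> z. theta_term q \<tau> z l)"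
    by (rule eventually_finite_subsets_at_top_weakI) (auto simp: f_def sum.inter_restrict)
  ultimately have "uniform_limit K
      (\<lambda>F (\<tau>, z). \<Sum>l \<in> F \<inter> theta_index (proj_cone C) \<tau> z. theta_term q \<tau> z l)
      (\<lambda>(\<tau>, z). theta q L (proj_cone C) \<tau> z) (finite_subsets_at_top L)"
    by (subst uniform_limit_cong[symmetric]) auto
  moreover have "(\<lambda>l. norm (theta_term q \<tau> z l)) summable_on (L \<inter> theta_index (proj_cone C) \<tau> z)"
    if "(\<tau>, z) \<in> K" for \<tau> z
    by (rule Infinite_Sum.abs_summable_on_comparison_test'[OF summable_on_subset_banach[OF M]])
      (use bound[OF that] in auto)
  ultimately show ?thesis by blast
qed

end
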